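(* Let $\Sigma\le S_n$ be a Young subgroup, $G\le\Sigma$ a subgroup of index $\ell=[\Sigma:G]$, and let $\theta_*=(\theta_1,\dots,\theta_\ell)$ be a set of secondary invariants for $\mathbb{Q}[V]^G$ (over $\mathbb{Q}[V]^\Sigma$) with each $\theta_i\in\mathbb{Z}[V]^G$. Let $\mho(\theta_* )$ be the content of the polynomial $\det M(\theta_* )\in\mathbb{Z}[V]$. Then for every prime $p\in\mathbb{Z}$: $p$ divides $\mho(\theta_* )$ if and only if $p$ is bad for $\theta_*$.
   Context: $\Sigma=S_{k_1}\times\cdots\times S_{k_r}$ with $k_1+\dots+k_r=n$. For a commutative ring $R$, $R[V]=R[x_1,\dots,x_n]$, on which $S_n$ acts by permuting the variables; $R[V]^H$ is the subring of $H$-invariants. The ring $R[V]^\Sigma$ is a polynomial ring over $R$. A set of secondary invariants (secondaries) for $\mathbb{Q}[V]^G$ is a minimal set of homogeneous generators of $\mathbb{Q}[V]^G$ as a $\mathbb{Q}[V]^\Sigma$-module; it has exactly $\ell$ elements and $\mathbb{Q}[V]^G=\bigoplus_{i=1}^\ell\mathbb{Q}[V]^\Sigma\theta_i$. Let $\gamma_1,\dots,\gamma_\ell$ be left coset representatives of $G$ in $\Sigma$, and $M(\theta_* )=[\gamma_i\theta_j]_{1\le i,j\le\ell}$. The content of a polynomial in $\mathbb{Z}[V]$ is the gcd of its coefficients. Let $\overline{\theta}_i\in\mathbb{F}_p[V]^G$ be the reduction of $\theta_i$ modulo $p$. The prime $p$ is good for $\theta_*$ if $\mathbb{F}_p[V]^G=\bigoplus_{i=1}^\ell\mathbb{F}_p[V]^\Sigma\,\overline{\theta}_i$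 (i.e. $\overline\theta_1,\dots,\overline\theta_\ell$ is a basis of $\mathbb{F}_p[V]^G$ as an $\mathbb{F}_p[V]^\Sigma$-module); otherwise $p$ is bad for $\theta_*$. *)

theory Defs
  imports
    "HOL-Library.Poly_Mapping"
    "HOL-Algebra.Sym_Groups"
    "HOL-Algebra.Left_Coset"
    "Jordan_Normal_Form.Determinant"
    "Berlekamp_Zassenhaus.Finite_Field"
begin

section \<open>Polynomials and the permutation action\<close>

text \<open>A polynomial maps monomials (exponent vectors) to coefficients. The variables are
  indexed by all natural numbers; \<open>mpoly_ring n\<close> is the subring $R[x_1,\dots,x_n]$.\<close>

type_synonym monomial = "nat \<Rightarrow>\<^sub>0 nat"
type_synonym 'a mpoly = "monomial \<Rightarrow>\<^sub>0 'a"

definition mpoly_ring :: "nat \<Rightarrow> 'a::comm_ring_1 mpoly set" where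
  "mpoly_ring n = {f. \<forall>m \<in> Poly_Mapping.keys f. Poly_Mapping.keys m \<subseteq> {1..n}}"

definition var :: "nat \<Rightarrow> 'a::comm_ring_1 mpoly" where
  "var i = Poly_Mapping.single (Poly_Mapping.single i 1) 1"

text \<open>The left action with $\sigma \cdot x_i = x_{\sigma(i)}$: the coefficient of $\sigma f$ at
  an exponent vector $m$ is the coefficient of $f$ at $m \circ \sigma$. The function
  \<open>map_key\<close> is precomposition only for injective maps, which is the case for permutations.\<close>

definition perm_poly :: "(nat \<Rightarrow> nat) \<Rightarrow> 'a::comm_ring_1 mpoly \<Rightarrow> 'a mpoly" where
  "perm_poly \<sigma> f = Poly_Mapping.map_key (Poly_Mapping.map_key \<sigma>) f"

lemma lookup_perm_poly:
  assumes "bij \<sigma>"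
  shows "Poly_Mapping.lookup (perm_poly \<sigma> f) m =
    Poly_Mapping.lookup f (Poly_Mapping.map_key \<sigma> m)"
proof -
  have inj: "inj (Poly_Mapping.map_key \<sigma> :: monomial \<Rightarrow> monomial)"
  proof (rule injI)
    fix x y :: monomial
    assume "Poly_Mapping.map_key \<sigma> x = Poly_Mapping.map_key \<sigma> y"
    then have "Poly_Mapping.lookup x (\<sigma> i) = Poly_Mapping.lookup y (\<sigma> i)" for i
      by (metis assms bij_is_inj map_key.rep_eq comp_apply)
    then show "x = y"
      by (metis assms bij_pointE poly_mapping_eqI)
  qed
  then show ?thesis
    by (simp add: perm_poly_def map_key.rep_eq)
qed

lemma perm_poly_var:
  assumes "bij \<sigma>"
  shows "perm_poly \<sigma> (var i :: 'a::comm_ring_1 mpoly) = var (\<sigma> i)"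
proof (rule poly_mapping_eqI)
  fix m :: monomial
  have "Poly_Mapping.map_key \<sigma> m = Poly_Mapping.single i 1 \<longleftrightarrow> m = Poly_Mapping.single (\<sigma> i) 1"
  proof
    assume *: "Poly_Mapping.map_key \<sigma> m = Poly_Mapping.single i 1"
    show "m = Poly_Mapping.single (\<sigma> i) 1"
    proof (rule poly_mapping_eqI)
      fix k
      obtain j where k: "k = \<sigma> j" using assms by (metis bij_pointE)
      have "Poly_Mapping.lookup m (\<sigma> j) = Poly_Mapping.lookup (Poly_Mapping.single i 1) j"
        using * assms by (metis bij_is_inj map_key.rep_eq comp_apply)
      then show "Poly_Mapping.lookup m k = Poly_Mapping.lookup (Poly_Mapping.single (\<sigma> i) 1) k"
        using assms by (simp add: k lookup_single when_def bij_is_inj inj_eq)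
    qed
  qed (use assms in \<open>simp add: bij_is_inj\<close>)
  then show "Poly_Mapping.lookup (perm_poly \<sigma> (var i :: 'a mpoly)) m = Poly_Mapping.lookup (var (\<sigma> i)) m"
    by (auto simp: lookup_perm_poly[OF assms] var_def lookup_single when_def)
qed

definition invariants :: "nat \<Rightarrow> (nat \<Rightarrow> nat) set \<Rightarrow> 'a::comm_ring_1 mpoly set" where
  "invariants n H = {f \<in> mpoly_ring n. \<forall>\<sigma> \<in> H. perm_poly \<sigma> f = f}"

definition monom_degree :: "monomial \<Rightarrow> nat" where
  "monom_degree m = (\<Sum>i \<in> Poly_Mapping.keys m. Poly_Mapping.lookup m i)"

definition homogeneous :: "'a::comm_ring_1 mpoly \<Rightarrow> bool" where
  "homogeneous f \<longleftrightarrow> (\<exists>d. \<forall>m \<in> Poly_Mapping.keys f. monom_degree m = d)"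

definition change_coeffs :: "int mpoly \<Rightarrow> 'a::comm_ring_1 mpoly" where
  "change_coeffs f = Poly_Mapping.map of_int f"

definition mpoly_content :: "int mpoly \<Rightarrow> int" where
  "mpoly_content f = Gcd (Poly_Mapping.lookup f ` Poly_Mapping.keys f)"


section \<open>Young subgroups\<close>

text \<open>The group $S_{k_1} \times \cdots \times S_{k_r}$ inside $S_n$, where $n = k_1 + \dots + k_r$
  and the $j$-th factor permutes the $j$-th of the consecutive blocks of lengths
  $k_1, \dots, k_r$ of $\{1,\dots,n\}$.\<close>

definition block :: "nat list \<Rightarrow> nat \<Rightarrow> nat set" where
  "block ks j = {sum_list (take j ks) <.. sum_list (take (Suc j) ks)}"

definition young_group :: "nat list \<Rightarrow> (nat \<Rightarrow> nat) monoid" where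
  "young_group ks = (sym_group (sum_list ks))
     \<lparr> carrier := {\<sigma>. \<sigma> permutes {1..sum_list ks} \<and> (\<forall>j < length ks. \<sigma> ` block ks j = block ks j)} \<rparr>"


section \<open>Modules over a ring of invariants\<close>

text \<open>Below, \<open>S\<close> is the carrier of a subring of the polynomial ring.\<close>

definition module_span :: "'a::comm_ring_1 mpoly set \<Rightarrow> 'a mpoly set \<Rightarrow> 'a mpoly set" where
  "module_span S B = {\<Sum>b\<in>F. c b * b | F c. finite F \<and> F \<subseteq> B \<and> (\<forall>b\<in>F. c b \<in> S)}"

definition module_basis ::
    "'a::comm_ring_1 mpoly set \<Rightarrow> 'a mpoly set \<Rightarrow> nat \<Rightarrow> (nat \<Rightarrow> 'a mpoly) \<Rightarrow> bool" where
  "module_basis S M l \<theta> \<longleftrightarrow>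
     M = {\<Sum>i<l. c i * \<theta> i | c. \<forall>i<l. c i \<in> S} \<and>
     (\<forall>c. (\<forall>i<l. c i \<in> S) \<and> (\<Sum>i<l. c i * \<theta> i) = 0 \<longrightarrow> (\<forall>i<l. c i = 0))"

definition secondary_invariants :: "nat list \<Rightarrow> (nat \<Rightarrow> nat) set \<Rightarrow> rat mpoly set \<Rightarrow> bool" where
  "secondary_invariants ks G B \<longleftrightarrow>
     (let n = sum_list ks; S = invariants n (carrier (young_group ks)) in
       (\<forall>f\<in>B. homogeneous f) \<and>
       module_span S B = invariants n G \<and>
       (\<forall>B'. B' \<subset> B \<longrightarrow> module_span S B' \<noteq> invariants n G))"

definition coset_representatives ::
    "('g, 'x) monoid_scheme \<Rightarrow> 'g set \<Rightarrow> nat \<Rightarrow> (nat \<Rightarrow> 'g) \<Rightarrow> bool" where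
  "coset_representatives \<Sigma> G l \<gamma> \<longleftrightarrow>
     (\<forall>i<l. \<gamma> i \<in> carrier \<Sigma>) \<and>
     bij_betw (\<lambda>i. \<gamma> i <#\<^bsub>\<Sigma>\<^esub> G) {..<l} (lcosets\<^bsub>\<Sigma>\<^esub> G)"

text \<open>Families of length $\ell$ are indexed by $0,\dots,\ell-1$.\<close>

definition secondary_matrix ::
    "nat \<Rightarrow> (nat \<Rightarrow> nat \<Rightarrow> nat) \<Rightarrow> (nat \<Rightarrow> int mpoly) \<Rightarrow> int mpoly mat" where
  "secondary_matrix l \<gamma> \<theta> = mat l l (\<lambda>(i, j). perm_poly (\<gamma> i) (\<theta> j))"

text \<open>The prime is $p = $ \<open>CARD('p)\<close>, and $\mathbb{F}_p$ is the type \<open>'p mod_ring\<close>.\<close>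

definition good_prime ::
    "'p::prime_card itself \<Rightarrow> nat list \<Rightarrow> (nat \<Rightarrow> nat) set \<Rightarrow> nat \<Rightarrow> (nat \<Rightarrow> int mpoly) \<Rightarrow> bool" where
  "good_prime _ ks G l \<theta> \<longleftrightarrow>
     (let n = sum_list ks in
       module_basis (invariants n (carrier (young_group ks))) (invariants n G) l
         (\<lambda>i. change_coeffs (\<theta> i) :: 'p mod_ring mpoly))"

abbreviation bad_prime ::
    "'p::prime_card itself \<Rightarrow> nat list \<Rightarrow> (nat \<Rightarrow> nat) set \<Rightarrow> nat \<Rightarrow> (nat \<Rightarrow> int mpoly) \<Rightarrow> bool" where
  "bad_prime P ks G l \<theta> \<equiv> \<not> good_prime P ks G l \<theta>"

end

theory Submission
  imports Defs
begin

text \<open>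
  The content of $\det M(\theta_*)$ is divisible by $p$ exactly when $\det M(\theta_*)$ vanishes
  modulo $p$, and reduction modulo $p$ commutes with the determinant. So the claim is that
  $\bar\theta_*$ is a basis of $\mathbb{F}_p[V]^G$ over $\mathbb{F}_p[V]^\Sigma$ if and only if
  $D = \det [\gamma_i \bar\theta_j] \neq 0$. Everything rests on the fact that the action of
  $\gamma_i$ is linear over the $\Sigma$-invariants.

  Suppose that $\bar\theta_*$ spans. The sum of the $G$-orbit of $x_1 x_2^2 \cdots x_n^n$ is a
  $G$-invariant $f$ whose conjugates $\gamma_i f$ are pairwise distinct. Writing
  $1, f, \dots, f^{\ell-1}$ as combinations of $\bar\theta_*$ shows that $D$ divides the
  determinant of $[(\gamma_i f)^j]$, which is a Vandermonde determinant with distinct nodes in an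
  integral domain. Hence $D \neq 0$ (\<open>det_nonzero_if_spans\<close>).

  Suppose conversely that $D \neq 0$. Applying each $\gamma_i$ to a linear relation between the
  $\bar\theta_j$ gives a homogeneous linear system with the matrix $[\gamma_i \bar\theta_j]$, so the
  $\bar\theta_j$ are independent (\<open>independent_if_det_nonzero\<close>). For the spanning property,
  lift an invariant modulo $p$ to an integral invariant $F$, expand $F$ over the rationals, and
  clear denominators: $N F = \sum_j C_j \theta_j$ with integral $\Sigma$-invariants $C_j$. If
  $p \mid N$, then reducing modulo $p$ gives a relation between the $\bar\theta_j$, so independence
  makes every $C_j$ divisible by $p$, and the equation can be divided by $p$. This reaches an $N$
  prime to $p$, which is invertible modulo $p$
  (\<open>saturated_integral_combination\<close>, \<open>reduction_spans\<close>).
\<close>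

section \<open>Coefficients, monomials and permutations\<close>

lemma poly_mapping_eq_sum_single:
  "f = (\<Sum>k\<in>Poly_Mapping.keys f. Poly_Mapping.single k (Poly_Mapping.lookup f k))"
  by (rule poly_mapping_eqI)
    (auto simp: lookup_sum lookup_single when_def in_keys_iff)

text \<open>By distributivity both sides are determined by their values on single terms. This gives
  multiplicativity both of a change of coefficients and of the action of a permutation.\<close>

lemma additive_multiplicative_if_on_single:
  fixes \<phi> :: "('k::monoid_add \<Rightarrow>\<^sub>0 'a::semiring_0) \<Rightarrow> ('k' :: monoid_add \<Rightarrow>\<^sub>0 'b::semiring_0)"
  assumes zero: "\<phi> 0 = 0"
    and add: "\<And>f g. \<phi> (f + g) = \<phi> f + \<phi> g"
    and single: "\<And>k a k' b. \<phi> (Poly_Mapping.single k a * Poly_Mapping.single k' b) =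
      \<phi> (Poly_Mapping.single k a) * \<phi> (Poly_Mapping.single k' b)"
  shows "\<phi> (f * g) = \<phi> f * \<phi> g"
proof -
  have sum: "\<phi> (\<Sum>x\<in>X. h x) = (\<Sum>x\<in>X. \<phi> (h x))" for X :: "'x set" and h
    by (induction X rule: infinite_finite_induct) (simp_all add: zero add)
  have right: "\<phi> (Poly_Mapping.single k a * g) = \<phi> (Poly_Mapping.single k a) * \<phi> g" for k a
    by (subst (1 2) poly_mapping_eq_sum_single[of g])
      (simp add: sum_distrib_left sum single)
  show ?thesis
    by (subst (1 2) poly_mapping_eq_sum_single[of f])
      (simp add: sum_distrib_right sum right)
qed

lemma lookup_map: "h 0 = 0 \<Longrightarrow> Poly_Mapping.lookup (Poly_Mapping.map h f) m = h (Poly_Mapping.lookup f m)"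
  by (auto simp: map.rep_eq when_def)

lemma lookup_const_mult:
  "Poly_Mapping.lookup (Poly_Mapping.single 0 c * f) m = c * Poly_Mapping.lookup f m"
  by (simp flip: mult_map_scale_conv_mult add: lookup_map)

lemma lookup_of_nat_mult: "Poly_Mapping.lookup (of_nat N * f) m = of_nat N * Poly_Mapping.lookup f m"
  using lookup_const_mult[of "of_nat N"] by simp

lemma lookup_change_coeffs [simp]:
  "Poly_Mapping.lookup (change_coeffs f) m = of_int (Poly_Mapping.lookup f m)"
  by (simp add: change_coeffs_def lookup_map)

interpretation change_coeffs: comm_ring_hom "change_coeffs :: int mpoly \<Rightarrow> 'a::comm_ring_1 mpoly"
proof
  show "change_coeffs 0 = (0 :: 'a mpoly)" by (rule poly_mapping_eqI) simp
  show "change_coeffs 1 = (1 :: 'a mpoly)"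
    by (rule poly_mapping_eqI) (simp add: lookup_one when_def)
  show add: "change_coeffs (f + g) = (change_coeffs f + change_coeffs g :: 'a mpoly)" for f g
    by (rule poly_mapping_eqI) (simp add: lookup_add)
  show "change_coeffs (f * g) = (change_coeffs f * change_coeffs g :: 'a mpoly)" for f g
  proof (rule additive_multiplicative_if_on_single)
    show "change_coeffs 0 = (0 :: 'a mpoly)" by (rule poly_mapping_eqI) simp
  qed (simp_all add: add, simp add: change_coeffs_def mult_single)
qed

lemma change_coeffs_rat_inj:
  "change_coeffs f = (change_coeffs g :: rat mpoly) \<Longrightarrow> f = g"
  by (metis lookup_change_coeffs of_int_eq_iff poly_mapping_eqI)

lemma perm_poly_add: "perm_poly \<sigma> (f + g) = perm_poly \<sigma> f + perm_poly \<sigma> g" if "bij \<sigma>"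
  by (rule poly_mapping_eqI) (simp add: lookup_perm_poly that lookup_add)

lemma perm_poly_zero: "perm_poly \<sigma> 0 = 0" if "bij \<sigma>"
  by (rule poly_mapping_eqI) (simp add: lookup_perm_poly that)

lemma perm_poly_sum: "perm_poly \<sigma> (sum f A) = (\<Sum>a\<in>A. perm_poly \<sigma> (f a))" if "bij \<sigma>"
  by (induction A rule: infinite_finite_induct)
    (simp_all add: perm_poly_zero perm_poly_add that)

lemma perm_poly_comp:
  assumes "bij \<sigma>" "bij \<tau>"
  shows "perm_poly \<sigma> (perm_poly \<tau> f) = perm_poly (\<sigma> \<circ> \<tau>) f"
  by (rule poly_mapping_eqI)
    (simp add: lookup_perm_poly assms bij_comp map_key_compose bij_is_inj)

lemma perm_poly_single:
  assumes "bij \<sigma>"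
  shows "perm_poly \<sigma> (Poly_Mapping.single m a) =
    Poly_Mapping.single (Poly_Mapping.map_key (inv_into UNIV \<sigma>) m) a"
proof -
  have "Poly_Mapping.map_key \<sigma> k = m \<longleftrightarrow> k = Poly_Mapping.map_key (inv_into UNIV \<sigma>) m" for k
  proof -
    have i: "inj \<sigma>" "inj (inv_into UNIV \<sigma>)"
      using assms bij_imp_bij_inv bij_is_inj by blast+
    have "\<sigma> \<circ> inv_into UNIV \<sigma> = (\<lambda>x. x)" "inv_into UNIV \<sigma> \<circ> \<sigma> = (\<lambda>x. x)"
      using assms by (auto simp: fun_eq_iff bij_is_surj surj_f_inv_f bij_is_inj)
    then show ?thesis
      using map_key_compose[OF i(1) i(2), of m] map_key_compose[OF i(2) i(1), of k]
      by (auto simp: map_key_id)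
  qed
  then have "m = Poly_Mapping.map_key \<sigma> k \<longleftrightarrow> Poly_Mapping.map_key (inv_into UNIV \<sigma>) m = k" for k
    by metis
  then show ?thesis
    by (intro poly_mapping_eqI) (simp add: lookup_perm_poly assms lookup_single when_def)
qed

lemma perm_poly_mult:
  assumes "bij \<sigma>"
  shows "perm_poly \<sigma> (f * g) = perm_poly \<sigma> f * perm_poly \<sigma> g"
  by (rule additive_multiplicative_if_on_single)
    (simp_all add: assms perm_poly_zero perm_poly_add perm_poly_single mult_single
      map_key_plus bij_is_inj bij_imp_bij_inv)

lemma perm_poly_one: "perm_poly \<sigma> 1 = 1" if "bij \<sigma>"
  using perm_poly_single[OF that, of 0 1] that by (simp add: bij_is_inj bij_imp_bij_inv)

lemma perm_poly_power: "perm_poly \<sigma> (f ^ j) = perm_poly \<sigma> f ^ j" if "bij \<sigma>"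
  by (induction j) (simp_all add: perm_poly_one perm_poly_mult that)

lemma perm_poly_map:
  "perm_poly \<sigma> (Poly_Mapping.map h f) = Poly_Mapping.map h (perm_poly \<sigma> f)"
  if "bij \<sigma>" "h 0 = 0"
  by (rule poly_mapping_eqI) (simp add: lookup_perm_poly lookup_map that)

section \<open>Rings of invariants\<close>

text \<open>The action only moves coefficients between monomials, so it commutes with applying any map
  that fixes zero to each coefficient, additive or not. This is what keeps invariance when an
  invariant is lifted from \<open>p\<close>-residues to integers, freed of denominators, or divided by an
  integer.\<close>

lemma map_in_invariants:
  assumes "f \<in> invariants n H" "h 0 = 0" "\<And>\<sigma>. \<sigma> \<in> H \<Longrightarrow> bij \<sigma>"
  shows "Poly_Mapping.map h f \<in> invariants n H"
proof -
  have "Poly_Mapping.keys (Poly_Mapping.map h f) \<subseteq> Poly_Mapping.keys f"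
    using assms(2) by (auto simp: in_keys_iff lookup_map)
  then show ?thesis
    using assms by (auto simp: invariants_def mpoly_ring_def perm_poly_map)
qed

lemma change_coeffs_in_invariants:
  assumes "f \<in> invariants n H" "\<And>\<sigma>. \<sigma> \<in> H \<Longrightarrow> bij \<sigma>"
  shows "change_coeffs f \<in> invariants n H"
  unfolding change_coeffs_def using assms by (intro map_in_invariants) auto

lemma zero_in_invariants: "0 \<in> invariants n H" if "\<And>\<sigma>. \<sigma> \<in> H \<Longrightarrow> bij \<sigma>"
  using that by (auto simp: invariants_def mpoly_ring_def perm_poly_zero)

lemma one_in_invariants: "1 \<in> invariants n H" if "\<And>\<sigma>. \<sigma> \<in> H \<Longrightarrow> bij \<sigma>"
  using that by (auto simp: invariants_def mpoly_ring_def perm_poly_one)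

lemma add_in_invariants:
  assumes "f \<in> invariants n H" "g \<in> invariants n H" "\<And>\<sigma>. \<sigma> \<in> H \<Longrightarrow> bij \<sigma>"
  shows "f + g \<in> invariants n H"
proof -
  have "f + g \<in> mpoly_ring n"
    using assms(1,2) Poly_Mapping.keys_add[of f g] unfolding invariants_def mpoly_ring_def by blast
  then show ?thesis
    using assms by (simp add: invariants_def perm_poly_add)
qed

lemma mult_in_invariants:
  assumes "f \<in> invariants n H" "g \<in> invariants n H" "\<And>\<sigma>. \<sigma> \<in> H \<Longrightarrow> bij \<sigma>"
  shows "f * g \<in> invariants n H"
proof -
  have "Poly_Mapping.keys m \<subseteq> {1..n}" if "m \<in> Poly_Mapping.keys (f * g)" for m
  proof -
    have "m \<in> {a + b | a b. a \<in> Poly_Mapping.keys f \<and> b \<in> Poly_Mapping.keys g}"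
      using keys_mult[of f g] that by blast
    then obtain a b where "m = a + b" "a \<in> Poly_Mapping.keys f" "b \<in> Poly_Mapping.keys g"
      by blast
    then show ?thesis
      using assms(1,2) Poly_Mapping.keys_add[of a b] unfolding invariants_def mpoly_ring_def by blast
  qed
  then show ?thesis
    using assms by (simp add: invariants_def mpoly_ring_def perm_poly_mult)
qed

lemma sum_in_invariants:
  assumes "\<And>i. i \<in> A \<Longrightarrow> f i \<in> invariants n H" "\<And>\<sigma>. \<sigma> \<in> H \<Longrightarrow> bij \<sigma>"
  shows "sum f A \<in> invariants n H"
  using assms
  by (induction A rule: infinite_finite_induct) (auto intro: zero_in_invariants add_in_invariants)

lemma power_in_invariants:
  assumes "f \<in> invariants n H" "\<And>\<sigma>. \<sigma> \<in> H \<Longrightarrow> bij \<sigma>"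
  shows "f ^ j \<in> invariants n H"
  using assms by (induction j) (auto intro: one_in_invariants mult_in_invariants)

lemma const_mult_in_invariants:
  assumes "f \<in> invariants n H" "\<And>\<sigma>. \<sigma> \<in> H \<Longrightarrow> bij \<sigma>"
  shows "Poly_Mapping.single 0 c * f \<in> invariants n H"
  unfolding mult_map_scale_conv_mult[symmetric] using assms by (intro map_in_invariants) auto

lemma invariants_antimono: "G \<subseteq> H \<Longrightarrow> invariants n H \<subseteq> invariants n G"
  by (auto simp: invariants_def)

section \<open>Matrices of conjugates\<close>

text \<open>The matrix $M(\theta_*)$ for an arbitrary ring of coefficients.\<close>

definition conjugate_matrix ::
    "nat \<Rightarrow> (nat \<Rightarrow> nat \<Rightarrow> nat) \<Rightarrow> (nat \<Rightarrow> 'a::comm_ring_1 mpoly) \<Rightarrow> 'a mpoly mat" where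
  "conjugate_matrix l \<gamma> t = mat l l (\<lambda>(i, j). perm_poly (\<gamma> i) (t j))"

text \<open>The group-theoretic data in elementary terms: \<open>H\<close> stands for $\Sigma$, and the last assumption
  says that distinct \<open>\<gamma> k\<close> represent distinct left cosets of \<open>G\<close>. Closure of \<open>G\<close> under inverses
  follows from finiteness.\<close>

locale coset_system =
  fixes n :: nat and H G :: "(nat \<Rightarrow> nat) set" and l :: nat and \<gamma> :: "nat \<Rightarrow> nat \<Rightarrow> nat"
  assumes permutes: "\<And>\<sigma>. \<sigma> \<in> H \<Longrightarrow> \<sigma> permutes {1..n}"
    and subset: "G \<subseteq> H"
    and id_in: "id \<in> G"
    and comp_in: "\<And>\<sigma> \<tau>. \<sigma> \<in> G \<Longrightarrow> \<tau> \<in> G \<Longrightarrow> \<sigma> \<circ> \<tau> \<in> G"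
    and rep_in: "\<And>i. i < l \<Longrightarrow> \<gamma> i \<in> H"
    and rep_distinct: "\<And>i k g. i < l \<Longrightarrow> k < l \<Longrightarrow> g \<in> G \<Longrightarrow> \<gamma> k \<circ> g = \<gamma> i \<Longrightarrow> k = i"
begin

lemma bij: "\<sigma> \<in> H \<Longrightarrow> bij \<sigma>"
  using permutes permutes_bij by blast

lemma bij_sub: "\<sigma> \<in> G \<Longrightarrow> bij \<sigma>"
  using bij subset by blast

lemma finite_G: "finite G"
  by (rule finite_subset[OF _ finite_permutations[of "{1..n}"]]) (use subset permutes in auto)

text \<open>An injective map of a finite set into itself is surjective; this takes the place of inverses
  in \<open>G\<close>.\<close>

lemma translate_bij: "\<sigma> \<in> G \<Longrightarrow> bij_betw ((\<circ>) \<sigma>) G G"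
proof -
  assume s: "\<sigma> \<in> G"
  have "inj_on ((\<circ>) \<sigma>) G"
    using bij_sub[OF s] by (metis bij_is_inj fun.inj_map inj_on_subset subset_UNIV)
  moreover have "(\<circ>) \<sigma> ` G \<subseteq> G" using comp_in s by auto
  ultimately show ?thesis
    by (simp add: bij_betw_def finite_G endo_inj_surj)
qed

lemma perm_poly_module_combination:
  assumes "i < l" "\<And>j. j \<in> A \<Longrightarrow> c j \<in> invariants n H"
  shows "perm_poly (\<gamma> i) (\<Sum>j\<in>A. c j * t j) = (\<Sum>j\<in>A. c j * perm_poly (\<gamma> i) (t j))"
proof -
  have "perm_poly (\<gamma> i) (c j) = c j" if "j \<in> A" for j
    using assms rep_in that by (auto simp: invariants_def)
  then show ?thesis
    by (simp add: perm_poly_sum perm_poly_mult bij rep_in assms(1))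
qed

text \<open>The witness is the orbit sum of $x_1 x_2^2 \cdots x_n^n$. The stabilizer of this monomial is
  trivial, so the terms of the conjugate under $\gamma_k$ correspond to the elements of the coset
  $\gamma_k G$, and different cosets are disjoint.\<close>

lemma ex_invariant_with_distinct_conjugates:
  "\<exists>f :: 'a::comm_ring_1 mpoly. f \<in> invariants n G \<and> inj_on (\<lambda>i. perm_poly (\<gamma> i) f) {..<l}"
proof -
  define \<delta> :: monomial where "\<delta> = (\<Sum>i\<in>{1..n}. Poly_Mapping.single i i)"
  have lookup_\<delta>: "Poly_Mapping.lookup \<delta> i = (if i \<in> {1..n} then i else 0)" for i
    by (auto simp: \<delta>_def lookup_sum lookup_single when_def)
  have stab: "\<pi> = id" if \<pi>: "\<pi> permutes {1..n}" and "Poly_Mapping.map_key \<pi> \<delta> = \<delta>" for \<pi>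
  proof
    fix i
    have "Poly_Mapping.lookup \<delta> (\<pi> i) = Poly_Mapping.lookup \<delta> i"
      using that by (metis permutes_inj map_key.rep_eq comp_apply)
    then show "\<pi> i = id i"
      using permutes_in_image[OF \<pi>, of i] permutes_not_in[OF \<pi>, of i]
      by (auto simp: lookup_\<delta> split: if_splits)
  qed
  define f :: "'a mpoly" where "f = (\<Sum>g\<in>G. perm_poly g (Poly_Mapping.single \<delta> 1))"
  have "f \<in> invariants n G"
  proof -
    have "perm_poly \<sigma> f = f" if "\<sigma> \<in> G" for \<sigma>
    proof -
      have "perm_poly \<sigma> f = (\<Sum>g\<in>G. perm_poly (\<sigma> \<circ> g) (Poly_Mapping.single \<delta> 1))"
        by (simp add: f_def perm_poly_sum perm_poly_comp bij_sub that)
      also have "\<dots> = f"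
        unfolding f_def using sum.reindex_bij_betw[OF translate_bij[OF that]] by simp
      finally show ?thesis .
    qed
    moreover have "f \<in> mpoly_ring n"
    proof -
      have "Poly_Mapping.keys (Poly_Mapping.map_key (inv_into UNIV g) \<delta>) \<subseteq> {1..n}" if "g \<in> G" for g
      proof -
        have g: "inv_into UNIV g permutes {1..n}"
          using that subset permutes permutes_inv by blast
        have "Poly_Mapping.keys \<delta> \<subseteq> {1..n}"
          by (rule subsetI) (simp add: in_keys_iff lookup_\<delta> split: if_splits)
        then show ?thesis
          using permutes_in_image[OF g] permutes_inj[OF g] by (auto simp only: keys_map_key vimage_def)
      qed
      then have "perm_poly g (Poly_Mapping.single \<delta> 1) \<in> mpoly_ring n" if "g \<in> G" for g
        using that by (simp add: mpoly_ring_def perm_poly_single bij_sub)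
      then show ?thesis
        unfolding mpoly_ring_def f_def
        using keys_sum[of "\<lambda>g. perm_poly g (Poly_Mapping.single \<delta> 1)" G] by blast
    qed
    ultimately show ?thesis by (simp add: invariants_def)
  qed
  moreover have "inj_on (\<lambda>i. perm_poly (\<gamma> i) f) {..<l}"
  proof (rule inj_onI)
    fix i k assume i: "i \<in> {..<l}" and k: "k \<in> {..<l}"
      and eq: "perm_poly (\<gamma> i) f = perm_poly (\<gamma> k) f"
    \<comment> \<open>The image of \<open>\<delta>\<close> under \<open>\<gamma> i\<close>: a monomial of the conjugate under \<open>\<gamma> i\<close>, and of no other.\<close>
    define m where "m = Poly_Mapping.map_key (inv_into UNIV (\<gamma> i)) \<delta>"
    have coeff: "Poly_Mapping.lookup (perm_poly (\<gamma> j) f) m =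
        (\<Sum>g\<in>G. if \<gamma> j \<circ> g = \<gamma> i then 1 else 0)" if "j < l" for j
    proof -
      have iff: "\<delta> = Poly_Mapping.map_key (\<gamma> j \<circ> g) m \<longleftrightarrow> \<gamma> j \<circ> g = \<gamma> i" if g: "g \<in> G" for g
      proof -
        have pi: "\<gamma> i permutes {1..n}" and pj: "\<gamma> j \<circ> g permutes {1..n}"
          using rep_in permutes subset g i \<open>j < l\<close> permutes_compose[of g "{1..n}" "\<gamma> j"]
          by (blast, blast)
        have p: "inv_into UNIV (\<gamma> i) \<circ> (\<gamma> j \<circ> g) permutes {1..n}"
          using permutes_compose[OF pj permutes_inv[OF pi]] .
        have "Poly_Mapping.map_key (\<gamma> j \<circ> g) m =
            Poly_Mapping.map_key (inv_into UNIV (\<gamma> i) \<circ> (\<gamma> j \<circ> g)) \<delta>"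
          unfolding m_def
          using permutes_inj[OF permutes_inv[OF pi]] permutes_inj[OF pj] by (simp add: map_key_compose)
        also have "\<dots> = \<delta> \<longleftrightarrow> inv_into UNIV (\<gamma> i) \<circ> (\<gamma> j \<circ> g) = id"
          using stab[OF p] map_key_id[of \<delta>] by (auto simp: id_def)
        also have "\<dots> \<longleftrightarrow> \<gamma> j \<circ> g = \<gamma> i"
          by (metis pi comp_assoc comp_id id_comp permutes_inv_o)
        finally show ?thesis by metis
      qed
      have "Poly_Mapping.lookup (perm_poly (\<gamma> j) f) m =
          (\<Sum>g\<in>G. Poly_Mapping.lookup (perm_poly (\<gamma> j \<circ> g) (Poly_Mapping.single \<delta> 1)) m)"
        by (simp add: f_def perm_poly_sum perm_poly_comp bij_sub bij rep_in that lookup_sum)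
      also have "\<dots> = (\<Sum>g\<in>G. if \<gamma> j \<circ> g = \<gamma> i then 1 else 0)"
        by (intro sum.cong refl)
          (auto simp: lookup_perm_poly bij_comp bij_sub bij rep_in that lookup_single when_def iff)
      finally show ?thesis .
    qed
    have only_id: "\<gamma> i \<circ> g = \<gamma> i \<longleftrightarrow> g = id" for g
      using rep_in[of i] bij[of "\<gamma> i"] i
      by (metis bij_is_inj comp_id fun.inj_map_strong inj_eq fun.inj_map lessThan_iff)
    have "Poly_Mapping.lookup (perm_poly (\<gamma> i) f) m = 1"
      using i id_in finite_G by (simp add: coeff only_id)
    then have "(\<Sum>g\<in>G. if \<gamma> k \<circ> g = \<gamma> i then 1 else 0 :: 'a) \<noteq> 0"
      using k by (simp add: eq coeff)
    then obtain g where "g \<in> G" "\<gamma> k \<circ> g = \<gamma> i"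
      by (auto elim!: sum.not_neutral_contains_not_neutral split: if_splits)
    then show "i = k" using rep_distinct i k by auto
  qed
  ultimately show ?thesis by blast
qed

text \<open>This is the Vandermonde matrix of the conjugates of \<open>f\<close>. A nonzero vector in its kernel would
  be the coefficient vector of a nonzero polynomial of degree below \<open>l\<close> with \<open>l\<close> distinct roots.\<close>

lemma det_conjugate_matrix_powers_nonzero:
  fixes f :: "'a::idom mpoly"
  assumes inj: "inj_on (\<lambda>i. perm_poly (\<gamma> i) f) {..<l}"
  shows "det (conjugate_matrix l \<gamma> (\<lambda>j. f ^ j)) \<noteq> 0"
proof
  let ?V = "conjugate_matrix l \<gamma> (\<lambda>j. f ^ j)"
  have V: "?V \<in> carrier_mat l l" by (simp add: conjugate_matrix_def)
  assume "det ?V = 0"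
  then obtain v where v: "v \<in> carrier_vec l" "v \<noteq> 0\<^sub>v l" "?V *\<^sub>v v = 0\<^sub>v l"
    using det_0_iff_vec_prod_zero[OF V] by blast
  define P where "P = (\<Sum>j<l. Polynomial.monom (v $ j) j)"
  have coeff_P: "Polynomial.coeff P j = (if j < l then v $ j else 0)" for j
    by (auto simp: P_def coeff_sum)
  have "P \<noteq> 0"
    using v(1,2) coeff_P by (metis carrier_vecD coeff_0 eq_vecI index_zero_vec)
  have "l \<noteq> 0" using v by auto
  have deg: "Polynomial.degree P < l"
    using \<open>l \<noteq> 0\<close> by (intro degree_lessI) (auto simp: coeff_P)
  have "poly P (perm_poly (\<gamma> i) f) = 0" if "i < l" for i
  proof -
    have "0 = (?V *\<^sub>v v) $ i" using v that by simp
    also have "\<dots> = (\<Sum>j<l. perm_poly (\<gamma> i) f ^ j * v $ j)"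
      using that v(1) V
      by (auto simp: conjugate_matrix_def scalar_prod_def perm_poly_power bij rep_in lessThan_atLeast0
          intro!: sum.cong)
    also have "\<dots> = poly P (perm_poly (\<gamma> i) f)"
      by (simp add: P_def poly_sum poly_monom mult.commute)
    finally show ?thesis by simp
  qed
  then have "(\<lambda>i. perm_poly (\<gamma> i) f) ` {..<l} \<subseteq> {x. poly P x = 0}" by auto
  then have "card {..<l} \<le> card {x. poly P x = 0}"
    using inj poly_roots_finite[OF \<open>P \<noteq> 0\<close>] card_inj_on_le by metis
  then show False
    using card_poly_roots_bound[OF \<open>P \<noteq> 0\<close>] deg by simp
qed

text \<open>Expressing the powers of \<open>f\<close> through the \<open>t i\<close> factors the Vandermonde matrix of the conjugates
  of \<open>f\<close> as the matrix of conjugates of \<open>t\<close> times a matrix of \<open>H\<close>-invariants.\<close>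

lemma det_nonzero_if_spans:
  fixes t :: "nat \<Rightarrow> 'a::idom mpoly"
  assumes spans: "\<And>f. f \<in> invariants n G \<Longrightarrow>
    \<exists>c. (\<forall>i<l. c i \<in> invariants n H) \<and> f = (\<Sum>i<l. c i * t i)"
  shows "det (conjugate_matrix l \<gamma> t) \<noteq> 0"
proof -
  obtain f :: "'a mpoly" where f: "f \<in> invariants n G" "inj_on (\<lambda>i. perm_poly (\<gamma> i) f) {..<l}"
    using ex_invariant_with_distinct_conjugates by blast
  have "\<exists>c. (\<forall>i<l. c i \<in> invariants n H) \<and> f ^ j = (\<Sum>i<l. c i * t i)" for j
    using spans power_in_invariants[OF f(1) bij_sub] by blast
  then obtain c where c: "\<And>j i. i < l \<Longrightarrow> c j i \<in> invariants n H"
    "\<And>j. f ^ j = (\<Sum>i<l. c j i * t i)" by metis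
  let ?M = "conjugate_matrix l \<gamma> t" and ?C = "mat l l (\<lambda>(k, j). c j k)"
  have M: "?M \<in> carrier_mat l l" by (simp add: conjugate_matrix_def)
  have "conjugate_matrix l \<gamma> (\<lambda>j. f ^ j) = ?M * ?C"
  proof (rule eq_matI)
    fix i j assume ij: "i < dim_row (?M * ?C)" "j < dim_col (?M * ?C)"
    then have il: "i < l" and jl: "j < l" by (simp_all add: conjugate_matrix_def)
    have "(\<Sum>k<l. c j k * perm_poly (\<gamma> i) (t k)) = (?M * ?C) $$ (i, j)"
      using il jl by (auto simp: conjugate_matrix_def scalar_prod_def lessThan_atLeast0 mult.commute
          intro!: sum.cong)
    then show "conjugate_matrix l \<gamma> (\<lambda>j. f ^ j) $$ (i, j) = (?M * ?C) $$ (i, j)"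
      using il jl perm_poly_module_combination[OF il, of "{..<l}" "c j" t] c(1)
      by (simp add: conjugate_matrix_def c(2))
  qed (simp_all add: conjugate_matrix_def)
  then have "det ?M * det ?C \<noteq> 0"
    using det_conjugate_matrix_powers_nonzero[OF f(2)] det_mult[OF M, of ?C] by simp
  then show ?thesis by auto
qed

text \<open>The \<open>\<gamma> k\<close> fix the coefficients of a relation, so these coefficients form a vector in the kernel
  of the matrix of conjugates.\<close>

lemma independent_if_det_nonzero:
  fixes t :: "nat \<Rightarrow> 'a::idom mpoly"
  assumes det: "det (conjugate_matrix l \<gamma> t) \<noteq> 0"
    and c: "\<And>i. i < l \<Longrightarrow> c i \<in> invariants n H"
    and eq: "(\<Sum>i<l. c i * t i) = 0"
    and "i < l"
  shows "c i = 0"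
proof -
  let ?M = "conjugate_matrix l \<gamma> t"
  have M: "?M \<in> carrier_mat l l" by (simp add: conjugate_matrix_def)
  have "?M *\<^sub>v vec l c = 0\<^sub>v l"
  proof (rule eq_vecI)
    fix k assume "k < dim_vec (0\<^sub>v l :: 'a mpoly vec)"
    then have k: "k < l" by simp
    have "(?M *\<^sub>v vec l c) $ k = (\<Sum>j<l. c j * perm_poly (\<gamma> k) (t j))"
      using k by (auto simp: conjugate_matrix_def scalar_prod_def lessThan_atLeast0 mult.commute
          intro!: sum.cong)
    also have "\<dots> = perm_poly (\<gamma> k) (\<Sum>j<l. c j * t j)"
      using c by (intro perm_poly_module_combination[OF k, symmetric]) auto
    finally show "(?M *\<^sub>v vec l c) $ k = 0\<^sub>v l $ k"
      using k by (simp add: eq perm_poly_zero bij rep_in)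
  qed (simp add: conjugate_matrix_def)
  then have "vec l c = 0\<^sub>v l"
    using det det_0_iff_vec_prod_zero[OF M] by (metis vec_carrier)
  then show ?thesis using \<open>i < l\<close> by (metis index_vec index_zero_vec(1))
qed

end

section \<open>Reduction modulo p\<close>

lemma of_int_mod_ring_eq_0_iff: "(of_int x :: 'p::prime_card mod_ring) = 0 \<longleftrightarrow> int CARD('p) dvd x"
  by (transfer, simp add: dvd_eq_mod_eq_0)

lemma dvd_content_iff_reduction_zero:
  "int CARD('p) dvd mpoly_content f \<longleftrightarrow> (change_coeffs f :: 'p::prime_card mod_ring mpoly) = 0"
proof -
  have "int CARD('p) dvd mpoly_content f \<longleftrightarrow> (\<forall>m. int CARD('p) dvd Poly_Mapping.lookup f m)"
  proof -
    have "int CARD('p) dvd Poly_Mapping.lookup f m" if "m \<notin> Poly_Mapping.keys f" for m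
      using that by (simp add: in_keys_iff)
    then show ?thesis
      unfolding mpoly_content_def dvd_Gcd_iff by blast
  qed
  then show ?thesis
    by (simp add: poly_mapping_eq_iff fun_eq_iff of_int_mod_ring_eq_0_iff)
qed

lemma finite_common_denominator:
  fixes A :: "rat set"
  assumes "finite A"
  shows "\<exists>N::nat. N > 0 \<and> (\<forall>a\<in>A. of_nat N * a \<in> \<int>)"
  using assms
proof induction
  case (insert a A)
  then obtain N :: nat where N: "N > 0" "\<forall>a\<in>A. of_nat N * a \<in> \<int>" by blast
  obtain x y where q: "quotient_of a = (x, y)" by force
  then have y: "y > 0" and a: "a = of_int x / of_int y"
    using quotient_of_denom_pos quotient_of_div by auto
  let ?N = "N * nat y"
  have e: "of_nat ?N = of_nat N * (of_int y :: rat)" using y by simp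
  have "of_nat ?N * a = of_nat N * of_int x" unfolding e using y by (simp add: a)
  then have "of_nat ?N * a \<in> \<int>" by (metis Ints_mult Ints_of_int Ints_of_nat)
  moreover have "of_nat ?N * b \<in> \<int>" if "b \<in> A" for b
  proof -
    have "of_nat ?N * b = of_int y * (of_nat N * b)" by (simp only: e ac_simps)
    then show ?thesis using N that by (metis Ints_mult Ints_of_int)
  qed
  ultimately show ?case using N(1) y by (intro exI[of _ ?N]) auto
qed (auto intro: exI[of _ 1])

lemma clear_denominators:
  fixes c :: "nat \<Rightarrow> rat mpoly"
  assumes c: "\<And>i. i < l \<Longrightarrow> c i \<in> invariants n H" and bij: "\<And>\<sigma>. \<sigma> \<in> H \<Longrightarrow> bij \<sigma>"
  obtains N :: nat and C :: "nat \<Rightarrow> int mpoly" where "N > 0"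
    "\<And>i. i < l \<Longrightarrow> C i \<in> invariants n H"
    "\<And>i. i < l \<Longrightarrow> change_coeffs (C i) = of_nat N * c i"
proof -
  obtain N :: nat where N: "N > 0"
    "\<forall>a \<in> (\<Union>i<l. Poly_Mapping.lookup (c i) ` Poly_Mapping.keys (c i)). of_nat N * a \<in> \<int>"
    using finite_common_denominator[of "\<Union>i<l. Poly_Mapping.lookup (c i) ` Poly_Mapping.keys (c i)"]
    by auto
  define C where "C i = Poly_Mapping.map (\<lambda>a. \<lfloor>of_nat N * a\<rfloor>) (c i)" for i
  have "change_coeffs (C i) = of_nat N * c i" if "i < l" for i
  proof (rule poly_mapping_eqI)
    fix m
    have "of_nat N * Poly_Mapping.lookup (c i) m \<in> \<int>"
      using N(2) that by (cases "m \<in> Poly_Mapping.keys (c i)") (auto simp: in_keys_iff)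
    then show "Poly_Mapping.lookup (change_coeffs (C i)) m =
        Poly_Mapping.lookup (of_nat N * c i) m"
      by (simp add: C_def lookup_map lookup_of_nat_mult)
  qed
  moreover have "C i \<in> invariants n H" if "i < l" for i
    unfolding C_def using c[OF that] bij by (intro map_in_invariants) auto
  ultimately show ?thesis using that N(1) by blast
qed

text \<open>Independence modulo \<open>p\<close> allows a factor \<open>p\<close> to be cancelled from \<open>N\<close> and all the
  \<open>C i\<close> at once: if \<open>p\<close> divides \<open>N\<close>, then the left side vanishes modulo \<open>p\<close>, so every \<open>C i\<close> vanishes
  there. The cancellation ends because \<open>N\<close> decreases.\<close>

lemma saturated_integral_combination:
  fixes \<theta> :: "nat \<Rightarrow> int mpoly" and F :: "int mpoly"
  assumes bij: "\<And>\<sigma>. \<sigma> \<in> H \<Longrightarrow> bij \<sigma>"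
    and indep: "\<And>c :: nat \<Rightarrow> 'p::prime_card mod_ring mpoly.
      (\<And>i. i < l \<Longrightarrow> c i \<in> invariants n H) \<Longrightarrow> (\<Sum>i<l. c i * change_coeffs (\<theta> i)) = 0 \<Longrightarrow>
      \<forall>i<l. c i = 0"
    and "N > 0" and "\<And>i. i < l \<Longrightarrow> C i \<in> invariants n H"
    and "of_nat N * F = (\<Sum>i<l. C i * \<theta> i)"
  shows "\<exists>N C. \<not> int CARD('p) dvd int N \<and> (\<forall>i<l. C i \<in> invariants n H) \<and>
    of_nat N * F = (\<Sum>i<l. C i * \<theta> i)"
  using assms(3-)
proof (induction N arbitrary: C rule: less_induct)
  case (less N)
  let ?p = "CARD('p)"
  have p: "?p > 1" using prime_card prime_gt_1_nat by blast
  show ?case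
  proof (cases "int ?p dvd int N")
    case True
    then obtain N' where N': "N = ?p * N'" by auto
    let ?c = "\<lambda>i. change_coeffs (C i) :: 'p mod_ring mpoly"
    have "(\<Sum>i<l. ?c i * change_coeffs (\<theta> i)) = change_coeffs (of_nat N * F)"
      by (simp add: less.prems(3) hom_distribs)
    also have "\<dots> = 0"
    proof -
      have "(of_nat N :: 'p mod_ring) = 0"
        using True of_int_mod_ring_eq_0_iff[where x = "int N" and 'p = 'p] by simp
      then have "(of_nat N :: 'p mod_ring mpoly) = 0"
        by (metis single_of_nat single_zero)
      then show ?thesis by (simp add: hom_distribs)
    qed
    finally have "\<forall>i<l. ?c i = 0"
      using less.prems(2) by (intro indep) (auto intro!: change_coeffs_in_invariants bij)
    then have dvd: "int ?p dvd Poly_Mapping.lookup (C i) m" if "i < l" for i m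
      using that by (metis lookup_change_coeffs lookup_zero of_int_mod_ring_eq_0_iff)
    define C' where "C' i = Poly_Mapping.map (\<lambda>a. a div int ?p) (C i)" for i
    have C': "C i = of_nat ?p * C' i" if "i < l" for i
      by (rule poly_mapping_eqI) (use dvd[OF that] in \<open>simp add: C'_def lookup_map lookup_of_nat_mult\<close>)
    have "of_nat ?p * (of_nat N' * F) =
        of_nat ?p * (\<Sum>i<l. C' i * \<theta> i)"
      using less.prems(3) C' by (simp add: N' sum_distrib_left mult.assoc)
    then have "of_nat N' * F = (\<Sum>i<l. C' i * \<theta> i)"
      using p by (subst (asm) mult_left_cancel) auto
    moreover have "C' i \<in> invariants n H" if "i < l" for i
      unfolding C'_def using less.prems(2)[OF that] bij by (intro map_in_invariants) auto
    moreover have "N' < N" "N' > 0" using less.prems(1) p N' by auto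
    ultimately show ?thesis using less.IH by blast
  qed (use less.prems in blast)
qed

text \<open>An expansion over the rationals is carried to \<open>p\<close>-residues through the integers. There it has
  a common denominator \<open>N\<close>, which first has to be made prime to \<open>p\<close>; then \<open>N\<close> is invertible
  modulo \<open>p\<close>.\<close>

lemma reduction_spans:
  fixes \<theta> :: "nat \<Rightarrow> int mpoly" and f :: "'p::prime_card mod_ring mpoly"
  assumes bijH: "\<And>\<sigma>. \<sigma> \<in> H \<Longrightarrow> bij \<sigma>" and bijG: "\<And>\<sigma>. \<sigma> \<in> G \<Longrightarrow> bij \<sigma>"
    and spans: "\<And>F :: rat mpoly. F \<in> invariants n G \<Longrightarrow>
      \<exists>c. (\<forall>i<l. c i \<in> invariants n H) \<and> F = (\<Sum>i<l. c i * change_coeffs (\<theta> i))"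
    and indep: "\<And>c :: nat \<Rightarrow> 'p mod_ring mpoly.
      (\<And>i. i < l \<Longrightarrow> c i \<in> invariants n H) \<Longrightarrow> (\<Sum>i<l. c i * change_coeffs (\<theta> i)) = 0 \<Longrightarrow>
      \<forall>i<l. c i = 0"
    and f: "f \<in> invariants n G"
  shows "\<exists>c. (\<forall>i<l. c i \<in> invariants n H) \<and> f = (\<Sum>i<l. c i * change_coeffs (\<theta> i))"
proof -
  \<comment> \<open>Lifting each coefficient to its representative in \<open>{0..<p}\<close> keeps the invariance.\<close>
  define F where "F = Poly_Mapping.map to_int_mod_ring f"
  have F: "F \<in> invariants n G"
    unfolding F_def using f bijG by (intro map_in_invariants) auto
  have f_eq: "f = change_coeffs F"
    by (rule poly_mapping_eqI) (simp add: F_def lookup_map of_int_of_int_mod_ring)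
  obtain c where c: "\<And>i. i < l \<Longrightarrow> c i \<in> invariants n H"
    "(change_coeffs F :: rat mpoly) = (\<Sum>i<l. c i * change_coeffs (\<theta> i))"
    using spans change_coeffs_in_invariants[OF F bijG] by blast
  obtain N C where NC: "N > 0" "\<And>i. i < l \<Longrightarrow> C i \<in> invariants n H"
    "\<And>i. i < l \<Longrightarrow> change_coeffs (C i) = of_nat N * c i"
    using clear_denominators[where c = c and l = l, OF c(1) bijH] by blast
  have "(change_coeffs (of_nat N * F) :: rat mpoly) =
      change_coeffs (\<Sum>i<l. C i * \<theta> i)"
    by (simp add: hom_distribs c(2) NC(3) sum_distrib_left mult.assoc)
  then have "of_nat N * F = (\<Sum>i<l. C i * \<theta> i)"
    by (rule change_coeffs_rat_inj)
  then obtain N C where N: "\<not> int CARD('p) dvd int N" and C: "\<forall>i<l. C i \<in> invariants n H"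
    and eq: "of_nat N * F = (\<Sum>i<l. C i * \<theta> i)"
    using saturated_integral_combination[where H = H and l = l and n = n and C = C and \<theta> = \<theta>,
        OF bijH indep NC(1,2)] by blast
  define u :: "'p mod_ring" where "u = of_int (int N)"
  have u: "inverse u * u = 1"
    using N of_int_mod_ring_eq_0_iff[where x = "int N" and 'p = 'p] by (simp add: u_def)
  have "Poly_Mapping.single 0 u * f = change_coeffs (of_nat N * F)"
    by (simp add: hom_distribs u_def f_eq)
  also have "\<dots> = (\<Sum>i<l. change_coeffs (C i) * change_coeffs (\<theta> i))"
    by (simp add: eq hom_distribs)
  finally have "Poly_Mapping.single 0 (inverse u) * (Poly_Mapping.single 0 u * f) =
      (\<Sum>i<l. Poly_Mapping.single 0 (inverse u) * change_coeffs (C i) * change_coeffs (\<theta> i))"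
    by (simp add: sum_distrib_left mult.assoc)
  then have "f = (\<Sum>i<l. Poly_Mapping.single 0 (inverse u) * change_coeffs (C i) * change_coeffs (\<theta> i))"
    by (simp add: mult.assoc[symmetric] mult_single u)
  then show ?thesis
    using C bijH by (intro exI[of _ "\<lambda>i. Poly_Mapping.single 0 (inverse u) * change_coeffs (C i)"])
      (auto intro!: const_mult_in_invariants change_coeffs_in_invariants)
qed

section \<open>Young subgroups and secondary invariants\<close>

text \<open>The sums in a span are indexed by the generators themselves. Injectivity of \<open>t\<close> permits
  reindexing by \<open>{..<l}\<close>, with zero coefficients for the generators that do not occur.\<close>

lemma module_span_image:
  fixes t :: "nat \<Rightarrow> 'a::comm_ring_1 mpoly"
  assumes "inj_on t {..<l}" "0 \<in> S" "f \<in> module_span S (t ` {..<l})"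
  shows "\<exists>c. (\<forall>i<l. c i \<in> S) \<and> f = (\<Sum>i<l. c i * t i)"
proof -
  obtain B c where B: "finite B" "B \<subseteq> t ` {..<l}" "\<forall>b\<in>B. c b \<in> S" and f: "f = (\<Sum>b\<in>B. c b * b)"
    using assms(3) unfolding module_span_def by blast
  let ?d = "\<lambda>b. if b \<in> B then c b else 0"
  have "f = (\<Sum>b\<in>t ` {..<l}. ?d b * b)"
    unfolding f using B(2) by (intro sum.mono_neutral_cong_left) (auto simp: subset_eq)
  also have "\<dots> = (\<Sum>i<l. ?d (t i) * t i)"
    using assms(1) by (simp add: sum.reindex)
  finally show ?thesis using B(3) assms(2) by (intro exI[of _ "\<lambda>i. ?d (t i)"]) auto
qed

lemma coset_system_young_group:
  assumes sub: "subgroup G (young_group ks)"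
    and reps: "coset_representatives (young_group ks) G l \<gamma>"
  shows "coset_system (sum_list ks) (carrier (young_group ks)) G l \<gamma>"
proof -
  have mult: "x \<otimes>\<^bsub>young_group ks\<^esub> y = x \<circ> y" for x y
    by (simp add: young_group_def sym_group_def)
  have one: "\<one>\<^bsub>young_group ks\<^esub> = id"
    by (simp add: young_group_def sym_group_def)
  have perm: "\<sigma> permutes {1..sum_list ks}" if "\<sigma> \<in> carrier (young_group ks)" for \<sigma>
    using that by (simp add: young_group_def)
  have bij_coset: "inj_on (\<lambda>i. \<gamma> i <#\<^bsub>young_group ks\<^esub> G) {..<l}"
    using reps by (simp add: coset_representatives_def bij_betw_def)
  note G = subgroup.subset[OF sub]
  have comp: "\<sigma> \<circ> \<tau> \<in> G" if "\<sigma> \<in> G" "\<tau> \<in> G" for \<sigma> \<tau>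
    using subgroup.m_closed[OF sub that] by (simp add: mult)
  \<comment> \<open>With \<open>l = 0\<close> the conditions on the representatives are void; the translations of \<open>G\<close> are then
    at hand for proving that the actual representatives are distinct.\<close>
  interpret trivial: coset_system "sum_list ks" "carrier (young_group ks)" G 0 \<gamma>
    using perm G comp subgroup.one_closed[OF sub] by unfold_locales (auto simp: one)
  show ?thesis
  proof
    fix i k g assume ik: "i < l" "k < l" and g: "g \<in> G" and eq: "\<gamma> k \<circ> g = \<gamma> i"
    have "\<gamma> i <#\<^bsub>young_group ks\<^esub> G = (\<lambda>h. \<gamma> k \<circ> (g \<circ> h)) ` G"
      by (auto simp: l_coset_def mult simp flip: eq comp_assoc)
    also have "\<dots> = (\<circ>) (\<gamma> k) ` ((\<circ>) g ` G)" by (simp add: image_image)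
    also have "\<dots> = \<gamma> k <#\<^bsub>young_group ks\<^esub> G"
      using trivial.translate_bij[OF g] by (auto simp: l_coset_def mult bij_betw_def)
    finally show "k = i" using bij_coset ik by (auto dest: inj_onD)
  qed (use perm G comp subgroup.one_closed[OF sub] reps in
      \<open>auto simp: one coset_representatives_def\<close>)
qed

theorem theorem4p4:
  fixes ks :: "nat list"
    and n l p :: nat
    and G :: "(nat \<Rightarrow> nat) set"
    and \<gamma> :: "nat \<Rightarrow> nat \<Rightarrow> nat"
    and \<theta> :: "nat \<Rightarrow> int mpoly"
  assumes "sum_list ks = n"
    and "subgroup G (young_group ks)"
    and "l = card (lcosets\<^bsub>young_group ks\<^esub> G)"
    and "coset_representatives (young_group ks) G l \<gamma>"
    and "\<forall>i<l. \<theta> i \<in> invariants n G"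
    and "inj_on \<theta> {..<l}"
    and "secondary_invariants ks G ((\<lambda>i. change_coeffs (\<theta> i)) ` {..<l})"
    and "Factorial_Ring.prime p"
    and "CARD('p::prime_card) = p"
  shows "int p dvd mpoly_content (det (secondary_matrix l \<gamma> \<theta>)) \<longleftrightarrow> bad_prime TYPE('p) ks G l \<theta>"
proof -
  let ?H = "carrier (young_group ks)"
  interpret coset_system n ?H G l \<gamma>
    using coset_system_young_group[OF assms(2,4)] assms(1) by simp
  let ?t = "\<lambda>i. change_coeffs (\<theta> i) :: 'p mod_ring mpoly"
  let ?M = "conjugate_matrix l \<gamma> ?t"
  have "map_mat change_coeffs (secondary_matrix l \<gamma> \<theta>) = ?M"
    by (rule eq_matI)
      (auto simp: secondary_matrix_def conjugate_matrix_def change_coeffs_def perm_poly_map bij rep_in)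
  then have det: "(change_coeffs (det (secondary_matrix l \<gamma> \<theta>)) :: 'p mod_ring mpoly) = det ?M"
    by (metis change_coeffs.hom_det)
  have good_iff: "good_prime TYPE('p) ks G l \<theta> \<longleftrightarrow> module_basis (invariants n ?H) (invariants n G) l ?t"
    using assms(1) by (simp add: good_prime_def)
  have rat_spans: "\<exists>c. (\<forall>i<l. c i \<in> invariants n ?H) \<and> F = (\<Sum>i<l. c i * change_coeffs (\<theta> i))"
    if "F \<in> invariants n G" for F :: "rat mpoly"
  proof (rule module_span_image)
    show "inj_on (\<lambda>i. change_coeffs (\<theta> i) :: rat mpoly) {..<l}"
      using assms(6) by (auto simp: inj_on_def dest!: change_coeffs_rat_inj)
    show "F \<in> module_span (invariants n ?H) ((\<lambda>i. change_coeffs (\<theta> i)) ` {..<l})"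
      using assms(1,7) that by (simp add: secondary_invariants_def Let_def)
  qed (rule zero_in_invariants[OF bij])
  have "det ?M \<noteq> 0 \<longleftrightarrow> good_prime TYPE('p) ks G l \<theta>"
  proof
    assume "good_prime TYPE('p) ks G l \<theta>"
    then show "det ?M \<noteq> 0"
      unfolding good_iff module_basis_def by (intro det_nonzero_if_spans) blast
  next
    assume "det ?M \<noteq> 0"
    then have indep: "\<forall>i<l. c i = 0"
      if "\<And>i. i < l \<Longrightarrow> c i \<in> invariants n ?H" "(\<Sum>i<l. c i * ?t i) = 0" for c
      using independent_if_det_nonzero that by blast
    have "(\<Sum>i<l. c i * ?t i) \<in> invariants n G" if "\<forall>i<l. c i \<in> invariants n ?H" for c
      using that assms(5) invariants_antimono[OF subset]
      by (intro sum_in_invariants mult_in_invariants change_coeffs_in_invariants bij_sub) auto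
    then have "invariants n G = {\<Sum>i<l. c i * ?t i | c. \<forall>i<l. c i \<in> invariants n ?H}"
      using reduction_spans[OF bij bij_sub rat_spans indep] by blast
    then show "good_prime TYPE('p) ks G l \<theta>"
      unfolding good_iff module_basis_def using indep by blast
  qed
  then show ?thesis
    unfolding assms(9)[symmetric] dvd_content_iff_reduction_zero det by blast
qed

end
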